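(* Let $X$ be a real Hilbert space and let $\Theta,\Gamma\subseteq(0,+\infty)$ be nonempty closed sets with $0\notin\Theta$, $0\notin\Gamma$. For all $(\theta,\gamma)\in\Theta\times\Gamma$, let $T_{\theta,\gamma}:X\to X$ be conically $\eta(\theta,\gamma)$-averaged for some $\eta(\theta,\gamma)>0$, with $0\notin\eta(\Theta\times\Gamma)$, and suppose that for some $\bar\theta\in\Theta$, $\operatorname{Fix}T_{\theta,\gamma}=\operatorname{Fix}T_{\bar\theta,\gamma}\neq\varnothing$ for all $(\theta,\gamma)\in\Theta\times\Gamma$. Let $(Q_{\delta\gets\gamma})_{\gamma,\delta\in\Gamma}$ be fixed-point relocators for $(T_{\bar\theta,\gamma})_{\gamma\in\Gamma}$ with Lipschitz constants $(\mathcal{L}_{\delta\gets\gamma})_{\gamma,\delta\in\Gamma}$ in $[1,+\infty)$. Let $(\gamma_k)_{k\in\mathbb{N}}\subseteq\Gamma$ be a sequence that converges to some $\bar\gamma\in\Gamma$ and satisfies $\sum_{k\in\mathbb{N}}(\mathcal{L}_{\gamma_{k+1}\gets\gamma_k}-1)<+\infty$. Let $(\theta_k)_{k\in\mathbb{N}}$ be a sequence in $\Theta$ and $(\lambda_k)_{k\in\mathbb{N}}$ a sequence in $(0,+\infty)$, and for all $k$ set $\eta_k:=\eta(\theta_k,\gamma_k)$; suppose that $\liminf_{k}\eta_k^{-1}\lambda_k(1-\eta_k\lambda_k)>0$. Let $z_0\in X$ and for all $k\in\mathbb{N}$ set $$z_{k+1}:=Q_{\gamma_{k+1}\gets\gamma_k}\big((1-\lambda_k)z_k+\lambda_kT_{\theta_k,\gamma_k}z_k\big).$$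 Then: (i) The sequence $(z_k)_{k\in\mathbb{N}}$ is bounded, and $(z_k-T_{\theta_k,\gamma_k}z_k)_{k\in\mathbb{N}}$ converges strongly to zero. (ii) If, in addition, for all $z\in X$ the map $\Theta\times\Gamma\ni(\theta,\gamma)\mapsto T_{\theta,\gamma}z$ is (strongly) continuous, $(\theta_k)_{k\in\mathbb{N}}$ is bounded and separated from zero, and $\liminf_k\eta_k>0$, then both $(z_k)_{k\in\mathbb{N}}$ and $(T_{\theta_k,\gamma_k}z_k)_{k\in\mathbb{N}}$ converge weakly to the same point in $\operatorname{Fix}T_{\bar\theta,\bar\gamma}$.
   Context: An operator $T:X\to X$ is conically $\eta$-averaged ($\eta>0$) if for all $x,y\in X$, $\|Tx-Ty\|^2+\frac{1-\eta}{\eta}\|(\mathrm{Id}-T)x-(\mathrm{Id}-T)y\|^2\le\|x-y\|^2$; equivalently, $T=(1-\eta)\mathrm{Id}+\eta N$ for some nonexpansive $N:X\to X$. $\operatorname{Fix}T=\{x:Tx=x\}$. Fixed-point relocators: given nonempty $\Gamma\subseteq(0,+\infty)$ and operators $(T_\gamma)_{\gamma\in\Gamma}$ on $X$, a family of operators $(Q_{\delta\gets\gamma})_{\gamma,\delta\in\Gamma}$ on $X$ defines fixed-point relocators for $(T_\gamma)_{\gamma\in\Gamma}$ with Lipschitz constants $(\mathcal{L}_{\delta\gets\gamma})_{\gamma,\delta\in\Gamma}$ in $[1,+\infty)$ if: (a) for all $\gamma,\delta\in\Gamma$, $Q_{\delta\gets\gamma}|_{\operatorname{Fix}T_\gamma}$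 is a bijection from $\operatorname{Fix}T_\gamma$ to $\operatorname{Fix}T_\delta$; (b) for all $\gamma\in\Gamma$, $x\in\operatorname{Fix}T_\gamma$, the map $\Gamma\ni\delta\mapsto Q_{\delta\gets\gamma}x$ is continuous; (c) for all $\gamma,\delta,\varepsilon\in\Gamma$, $x\in\operatorname{Fix}T_\gamma$, $Q_{\varepsilon\gets\delta}Q_{\delta\gets\gamma}x=Q_{\varepsilon\gets\gamma}x$; (d) for all $\gamma,\delta\in\Gamma$, $Q_{\delta\gets\gamma}$ is $\mathcal{L}_{\delta\gets\gamma}$-Lipschitz continuous on $X$. A sequence of positive reals is separated from zero if it is bounded below by a positive constant. *)

theory Defs
  imports "HOL-Analysis.Analysis"
begin

definition Fix :: "('a \<Rightarrow> 'a) \<Rightarrow> 'a set" where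
  "Fix T = {x. T x = x}"

definition conically_averaged :: "real \<Rightarrow> ('a::real_normed_vector \<Rightarrow> 'a) \<Rightarrow> bool" where
  "conically_averaged \<eta> T \<longleftrightarrow> \<eta> > 0 \<and>
     (\<forall>x y. (norm (T x - T y))\<^sup>2 + (1 - \<eta>) / \<eta> * (norm ((x - T x) - (y - T y)))\<^sup>2
             \<le> (norm (x - y))\<^sup>2)"

text \<open>Here \<open>Q \<delta> \<gamma>\<close> and \<open>L \<delta> \<gamma>\<close> stand for the operator and the Lipschitz constant with
  subscript \<open>\<delta> \<leftarrow> \<gamma>\<close>: the target parameter is the first argument. Only the values at
  parameters in \<open>\<Gamma>\<close> matter.\<close>

definition fixed_point_relocators ::
  "real set \<Rightarrow> (real \<Rightarrow> 'a \<Rightarrow> 'a) \<Rightarrow> (real \<Rightarrow> real \<Rightarrow> 'a \<Rightarrow> 'a::real_normed_vector)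
     \<Rightarrow> (real \<Rightarrow> real \<Rightarrow> real) \<Rightarrow> bool" where
  "fixed_point_relocators \<Gamma> T Q L \<longleftrightarrow>
     (\<forall>\<gamma>\<in>\<Gamma>. \<forall>\<delta>\<in>\<Gamma>. L \<delta> \<gamma> \<ge> 1) \<and>
     (\<forall>\<gamma>\<in>\<Gamma>. \<forall>\<delta>\<in>\<Gamma>. bij_betw (Q \<delta> \<gamma>) (Fix (T \<gamma>)) (Fix (T \<delta>))) \<and>
     (\<forall>\<gamma>\<in>\<Gamma>. \<forall>x\<in>Fix (T \<gamma>). continuous_on \<Gamma> (\<lambda>\<delta>. Q \<delta> \<gamma> x)) \<and>
     (\<forall>\<gamma>\<in>\<Gamma>. \<forall>\<delta>\<in>\<Gamma>. \<forall>\<epsilon>\<in>\<Gamma>. \<forall>x\<in>Fix (T \<gamma>). Q \<epsilon> \<delta> (Q \<delta> \<gamma> x) = Q \<epsilon> \<gamma> x) \<and>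
     (\<forall>\<gamma>\<in>\<Gamma>. \<forall>\<delta>\<in>\<Gamma>. (L \<delta> \<gamma>)-lipschitz_on UNIV (Q \<delta> \<gamma>))"

definition separated_from_zero :: "(nat \<Rightarrow> real) \<Rightarrow> bool" where
  "separated_from_zero s \<longleftrightarrow> (\<exists>c>0. \<forall>k. c \<le> s k)"

text \<open>Weak convergence in a Hilbert space, with the continuous linear functionals written as
  inner products.\<close>

definition weakly_converges :: "(nat \<Rightarrow> 'a::real_inner) \<Rightarrow> 'a \<Rightarrow> bool" where
  "weakly_converges s l \<longleftrightarrow> (\<forall>u. (\<lambda>k. s k \<bullet> u) \<longlonglongrightarrow> l \<bullet> u)"

end

theory Submission
  imports Defs
begin

text \<open>For a fixed point \<open>y\<close> at the limit parameter, the relocated points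
  \<open>x\<^sub>k = Q (\<gamma> k) \<gamma>bar y\<close> converge to \<open>y\<close> and are mapped to each other by the same relocators
  that drive the iteration, so \<open>z\<close> is quasi-Fejer with respect to \<open>(x\<^sub>k)\<close>: the distances
  \<open>norm (z k - x\<^sub>k)\<close> converge and the residuals vanish. For the weak limit, weak sequential
  compactness is not needed: along every subsequence there is a point in the intersection of the
  closed convex hulls of the tails, monotonicity of \<open>Id - T\<close> makes it a fixed point, and Opial's
  argument shows that all these points coincide.\<close>

subsection \<open>Conically averaged operators and relocators\<close>

text \<open>Expanding \<open>T x - T y\<close> as \<open>(x - y) - d\<close> raises the coefficient
  of the squared norm of \<open>d\<close> from \<open>(1 - \<eta>) / \<eta>\<close> to
  \<open>1 / \<eta>\<close>: the averagedness inequality is cocoercivity of Id - T with constant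
  \<open>1 / (2 * \<eta>)\<close>, for every positive \<eta>.\<close>

lemma conically_averaged_inner:
  fixes T :: "'a::real_inner \<Rightarrow> 'a"
  assumes "conically_averaged \<eta> T"
  shows "(norm ((x - T x) - (y - T y)))\<^sup>2 \<le> 2 * \<eta> * ((x - y) \<bullet> ((x - T x) - (y - T y)))"
proof -
  define d where "d = (x - T x) - (y - T y)"
  have pos: "\<eta> > 0"
    and le: "(norm (T x - T y))\<^sup>2 + (1 - \<eta>) / \<eta> * (norm d)\<^sup>2 \<le> (norm (x - y))\<^sup>2"
    using assms by (auto simp: conically_averaged_def d_def)
  have "T x - T y = (x - y) - d"
    by (simp add: d_def)
  then have "(norm (T x - T y))\<^sup>2 = (norm (x - y))\<^sup>2 - 2 * ((x - y) \<bullet> d) + (norm d)\<^sup>2"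
    by (simp only: power2_norm_eq_inner) (simp add: inner_diff inner_commute)
  with le have "(norm d)\<^sup>2 + (1 - \<eta>) / \<eta> * (norm d)\<^sup>2 \<le> 2 * ((x - y) \<bullet> d)"
    by linarith
  moreover have "(norm d)\<^sup>2 + (1 - \<eta>) / \<eta> * (norm d)\<^sup>2 = (norm d)\<^sup>2 / \<eta>"
    using pos by (simp add: field_simps)
  ultimately show ?thesis
    using pos by (simp add: d_def field_simps)
qed

text \<open>The new iterate is \<open>z - l *\<^sub>R r\<close> with \<open>r\<close> the residual,
  which vanishes at \<open>x\<close>. Cocoercivity controls the cross term of the squared distance
  to \<open>x\<close>, so the gain has coefficient \<open>l / \<eta> - l^2\<close>, the factor whose
  liminf the theorem bounds below.\<close>

lemma conically_averaged_relaxed_step: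
  fixes T :: "'a::real_inner \<Rightarrow> 'a"
  assumes "conically_averaged \<eta> T" and "x \<in> Fix T" and "l \<ge> 0"
  shows "(norm ((1 - l) *\<^sub>R z + l *\<^sub>R T z - x))\<^sup>2
    \<le> (norm (z - x))\<^sup>2 - inverse \<eta> * l * (1 - \<eta> * l) * (norm (z - T z))\<^sup>2"
proof -
  define r where "r = z - T z"
  have pos: "\<eta> > 0"
    using assms by (auto simp: conically_averaged_def)
  have "(norm r)\<^sup>2 \<le> 2 * \<eta> * ((z - x) \<bullet> r)"
    using conically_averaged_inner[OF assms(1), of z x] assms(2) by (simp add: Fix_def r_def)
  then have "inverse \<eta> * (norm r)\<^sup>2 \<le> 2 * ((z - x) \<bullet> r)"
    using pos by (simp add: field_simps)
  then have *: "l * (inverse \<eta> * (norm r)\<^sup>2) \<le> l * (2 * ((z - x) \<bullet> r))"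
    using assms(3) by (rule mult_left_mono)
  have "(1 - l) *\<^sub>R z + l *\<^sub>R T z - x = (z - x) - l *\<^sub>R r"
    by (simp add: r_def algebra_simps)
  then have "(norm ((1 - l) *\<^sub>R z + l *\<^sub>R T z - x))\<^sup>2
    = (norm (z - x))\<^sup>2 - l * (2 * ((z - x) \<bullet> r)) + l\<^sup>2 * (norm r)\<^sup>2"
    by (simp only: power2_norm_eq_inner)
       (simp add: inner_diff inner_commute power2_eq_square algebra_simps)
  moreover have "inverse \<eta> * l * (1 - \<eta> * l) * (norm r)\<^sup>2
    = l * (inverse \<eta> * (norm r)\<^sup>2) - l\<^sup>2 * (norm r)\<^sup>2"
    using pos by (simp add: field_simps power2_eq_square)
  ultimately show ?thesis
    using * unfolding r_def by linarith
qed

text \<open>The composition law makes \<open>Q g g\<close> idempotent on the fixed-point set, and an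
  injective idempotent map is the identity.\<close>

lemma relocator_self:
  assumes "fixed_point_relocators \<Gamma> T Q L" and "g \<in> \<Gamma>" and "x \<in> Fix (T g)"
  shows "Q g g x = x"
proof -
  have bij: "bij_betw (Q g g) (Fix (T g)) (Fix (T g))" and "Q g g (Q g g x) = Q g g x"
    using assms unfolding fixed_point_relocators_def by blast+
  moreover have "Q g g x \<in> Fix (T g)"
    using bij assms(3) by (auto simp: bij_betw_def)
  ultimately show ?thesis
    using assms(3) by (auto simp: bij_betw_def dest: inj_onD)
qed

lemma relocated_tendsto:
  assumes "fixed_point_relocators \<Gamma> T Q L" and "\<forall>k. \<gamma> k \<in> \<Gamma>" and "g \<in> \<Gamma>" and "\<gamma> \<longlonglongrightarrow> g"
    and "x \<in> Fix (T g)"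
  shows "(\<lambda>k. Q (\<gamma> k) g x) \<longlonglongrightarrow> x"
proof -
  have "continuous_on \<Gamma> (\<lambda>d. Q d g x)"
    using assms unfolding fixed_point_relocators_def by blast
  then have "(\<lambda>k. Q (\<gamma> k) g x) \<longlonglongrightarrow> Q g g x"
    by (rule continuous_on_tendsto_compose) (use assms in auto)
  then show ?thesis
    using relocator_self assms by metis
qed

subsection \<open>Quasi-Fejer sequences\<close>

text \<open>Rescaling by \<open>exp (- (\<Sum>j<k. L j - 1))\<close> makes the sequence nonincreasing.\<close>

lemma convergent_quasi_decreasing:
  fixes a L :: "nat \<Rightarrow> real"
  assumes nonneg: "\<And>k. a k \<ge> 0"
    and step: "\<forall>\<^sub>F k in sequentially. a (Suc k) \<le> L k * a k"
    and summ: "summable (\<lambda>k. L k - 1)"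
  shows "convergent a"
proof -
  define E where "E k = exp (- (\<Sum>j<k. L j - 1))" for k
  from step obtain N where N: "\<And>k. k \<ge> N \<Longrightarrow> a (Suc k) \<le> L k * a k"
    by (auto simp: eventually_sequentially)
  have dec: "a (Suc k) * E (Suc k) \<le> a k * E k" if "k \<ge> N" for k
  proof -
    \<comment> \<open>From \<open>1 + t \<le> exp t\<close>; the factor \<open>exp (L k - 1)\<close>
      is exactly the ratio \<open>E k / E (Suc k)\<close>.\<close>
    have "L k \<le> exp (L k - 1)"
      using exp_ge_add_one_self[of "L k - 1"] by simp
    then have "a (Suc k) \<le> exp (L k - 1) * a k"
      using N[OF that] mult_right_mono nonneg order_trans by meson
    then have "a (Suc k) * E (Suc k) \<le> exp (L k - 1) * a k * E (Suc k)"
      by (intro mult_right_mono) (auto simp: E_def)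
    also have "\<dots> = a k * (exp (L k - 1) * E (Suc k))"
      by simp
    also have "exp (L k - 1) * E (Suc k) = E k"
      by (simp add: E_def flip: exp_add)
    finally show ?thesis .
  qed
  have "decseq (\<lambda>k. a (k + N) * E (k + N))"
    using dec by (intro decseq_SucI) auto
  moreover have "0 \<le> a (k + N) * E (k + N)" for k
    using nonneg by (simp add: E_def)
  ultimately obtain b where "(\<lambda>k. a (k + N) * E (k + N)) \<longlonglongrightarrow> b"
    using decseq_convergent by blast
  then have 1: "(\<lambda>k. a k * E k) \<longlonglongrightarrow> b"
    by (rule LIMSEQ_offset)
  \<comment> \<open>Summability makes the limit of the rescaling factor positive, so the rescaling
    can be undone by division.\<close>
  have 2: "E \<longlonglongrightarrow> exp (- (\<Sum>j. L j - 1))"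
    unfolding E_def using summable_LIMSEQ[OF summ] by (intro tendsto_intros)
  have "(\<lambda>k. a k * E k / E k) \<longlonglongrightarrow> b / exp (- (\<Sum>j. L j - 1))"
    by (intro tendsto_divide 1 2) simp
  then show ?thesis
    by (auto simp: convergent_def E_def)
qed

subsection \<open>Weak convergence without weak compactness\<close>

text \<open>By the separation theorem, the condition says that \<open>p\<close> lies in the closed convex hull of
  every tail of \<open>w\<close>.\<close>

definition hull_cluster_point :: "(nat \<Rightarrow> 'a::real_inner) \<Rightarrow> 'a \<Rightarrow> bool" where
  "hull_cluster_point w p \<longleftrightarrow> (\<forall>u c. (\<forall>\<^sub>F k in sequentially. c \<le> w k \<bullet> u) \<longrightarrow> c \<le> p \<bullet> u)"

lemma hull_cluster_point_subseq:
  assumes "hull_cluster_point (w \<circ> r) p" and "strict_mono r"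
  shows "hull_cluster_point w p"
  using assms eventually_subseq[OF assms(2)] unfolding hull_cluster_point_def by fastforce

text \<open>Extends the defining condition from constant lower bounds to convergent ones: each
  constant \<open>l - e\<close> is eventually below \<open>b k\<close>, and \<open>e\<close> is
  arbitrary.\<close>

lemma hull_cluster_point_ge_lim:
  assumes p: "hull_cluster_point w p" and b: "b \<longlonglongrightarrow> l" and le: "\<And>k. b k \<le> w k \<bullet> u"
  shows "l \<le> p \<bullet> u"
proof (rule field_le_epsilon)
  fix e :: real
  assume "e > 0"
  then have "\<forall>\<^sub>F k in sequentially. l - e < b k"
    using b by (intro order_tendstoD) auto
  then have "\<forall>\<^sub>F k in sequentially. l - e \<le> w k \<bullet> u"
    by eventually_elim (use le in \<open>meson less_imp_le order_trans\<close>)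
  with p have "l - e \<le> p \<bullet> u"
    by (simp add: hull_cluster_point_def)
  then show "l \<le> p \<bullet> u + e"
    by simp
qed

lemma hull_cluster_point_lim:
  assumes p: "hull_cluster_point w p" and l: "(\<lambda>k. w k \<bullet> u) \<longlonglongrightarrow> l"
  shows "p \<bullet> u = l"
proof (rule antisym)
  show "l \<le> p \<bullet> u"
    using hull_cluster_point_ge_lim[OF p l] by simp
  have "- l \<le> p \<bullet> (- u)"
    by (rule hull_cluster_point_ge_lim[OF p tendsto_minus[OF l]]) simp
  then show "p \<bullet> u \<le> l"
    by simp
qed

text \<open>Almost minimal norm elements of the sets form a Cauchy sequence, by the parallelogram law.\<close>

lemma nested_convex_Inter_nonempty:
  fixes C :: "nat \<Rightarrow> 'a::{real_inner, complete_space} set"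
  assumes "decseq C" and closed: "\<And>n. closed (C n)" and convex: "\<And>n. convex (C n)"
    and ne: "\<And>n. w n \<in> C n" and bdd: "bounded (range w)"
  shows "(\<Inter>n. C n) \<noteq> {}"
proof -
  have mono: "C n \<subseteq> C m" if "m \<le> n" for m n
    using \<open>decseq C\<close> that by (auto simp: decseq_def)
  \<comment> \<open>Squared distance of \<open>C n\<close> from the origin. It increases as the sets
    shrink, and the bounded selection \<open>w\<close> keeps it bounded, so it has a limit
    \<open>D\<close>.\<close>
  define d where "d n = (INF x\<in>C n. (norm x)\<^sup>2)" for n
  have bb: "bdd_below ((\<lambda>x. (norm x)\<^sup>2) ` C n)" for n
    by (rule bdd_belowI[of _ 0]) auto
  have d_le: "d n \<le> (norm x)\<^sup>2" if "x \<in> C n" for n x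
    unfolding d_def using bb that by (rule cINF_lower)
  obtain B where B: "\<And>n. norm (w n) \<le> B"
    using bdd by (auto simp: bounded_iff)
  have "d n \<le> B\<^sup>2" for n
    using d_le[OF ne] power_mono[OF B norm_ge_zero] order_trans by blast
  moreover have "incseq d"
    unfolding incseq_def d_def
  proof (intro allI impI cINF_superset_mono bb)
    show "C n \<noteq> {}" for n
      using ne by blast
  qed (use mono in auto)
  ultimately obtain D where D: "d \<longlonglongrightarrow> D" "\<And>n. d n \<le> D"
    using incseq_convergent by blast
  have "\<exists>x\<in>C n. (norm x)\<^sup>2 < d n + inverse (real (Suc n))" for n
  proof -
    have "d n < d n + inverse (real (Suc n))"
      by simp
    then show ?thesis
      using cINF_less_iff[OF _ bb, of n "d n + inverse (real (Suc n))"] ne unfolding d_def by blast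
  qed
  then obtain x where xC: "\<And>n. x n \<in> C n"
    and x: "\<And>n. (norm (x n))\<^sup>2 < d n + inverse (real (Suc n))"
    by metis
  have dist: "(norm (x m - x n))\<^sup>2 \<le> 4 * (D + inverse (real (Suc n)) - d n)" if "n \<le> m" for m n
  proof -
    have "x m \<in> C n"
      using xC mono[OF that] by blast
    \<comment> \<open>The midpoint stays in the larger set \<open>C n\<close> by convexity, so its
      squared norm is at least \<open>d n\<close>; the parallelogram law turns this into an upper
      bound on the distance of \<open>x m\<close> and \<open>x n\<close>.\<close>
    then have "(1/2) *\<^sub>R x m + (1/2) *\<^sub>R x n \<in> C n"
      using convexD[OF convex _ xC] by simp
    then have "d n \<le> (norm ((1/2) *\<^sub>R x m + (1/2) *\<^sub>R x n))\<^sup>2"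
      by (rule d_le)
    also have "\<dots> = (norm (x m))\<^sup>2 / 2 + (norm (x n))\<^sup>2 / 2 - (norm (x m - x n))\<^sup>2 / 4"
      by (simp only: power2_norm_eq_inner) (simp add: inner_add inner_diff inner_commute field_simps)
    finally have *: "(norm (x m - x n))\<^sup>2 \<le> 2 * (norm (x m))\<^sup>2 + 2 * (norm (x n))\<^sup>2 - 4 * d n"
      by linarith
    have "inverse (real (Suc m)) \<le> inverse (real (Suc n))"
      using that by simp
    then have "(norm (x m))\<^sup>2 \<le> D + inverse (real (Suc n))"
      using x[of m] D(2)[of m] by linarith
    moreover have "(norm (x n))\<^sup>2 \<le> D + inverse (real (Suc n))"
      using x[of n] D(2)[of n] by linarith
    ultimately show ?thesis
      using * by argo
  qed
  have "(\<lambda>n. 4 * (D + inverse (real (Suc n)) - d n)) \<longlonglongrightarrow> 4 * (D + 0 - D)"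
    by (intro tendsto_intros D(1) LIMSEQ_inverse_real_of_nat)
  then have lim: "(\<lambda>n. 4 * (D + inverse (real (Suc n)) - d n)) \<longlonglongrightarrow> 0"
    by simp
  have "Cauchy x"
  proof (rule CauchyI')
    fix e :: real
    assume "e > 0"
    then have "\<forall>\<^sub>F n in sequentially. 4 * (D + inverse (real (Suc n)) - d n) < e\<^sup>2"
      using lim by (intro order_tendstoD) auto
    then obtain M where M: "\<And>n. n \<ge> M \<Longrightarrow> 4 * (D + inverse (real (Suc n)) - d n) < e\<^sup>2"
      by (auto simp: eventually_sequentially)
    have "norm (x m - x n) < e" if "m \<ge> M" "n > m" for m n
      using dist[of m n] M[of m] that \<open>e > 0\<close>
      by (intro power2_less_imp_less[of _ e]) (auto simp: norm_minus_commute)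
    then show "\<exists>M. \<forall>m\<ge>M. \<forall>n>m. dist (x m) (x n) < e"
      by (auto simp: dist_norm)
  qed
  then obtain p where p: "x \<longlonglongrightarrow> p"
    using Cauchy_convergent convergent_def by blast
  have "p \<in> C n" for n
  proof (rule Lim_in_closed_set[OF closed _ _ p])
    show "\<forall>\<^sub>F k in sequentially. x k \<in> C n"
      using eventually_ge_at_top[of n] by eventually_elim (use xC mono in blast)
  qed simp
  then show ?thesis
    by blast
qed

text \<open>Closed convex hulls of tails are nested and have a common point. A closed half-space
  that contains a tail contains its closed convex hull, hence that point.\<close>

lemma bounded_imp_hull_cluster_point:
  fixes w :: "nat \<Rightarrow> 'a::{real_inner, complete_space}"
  assumes "bounded (range w)"
  obtains p where "hull_cluster_point w p"
proof -
  define C where "C n = closure (convex hull (w ` {n..}))" for n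
  have "(\<Inter>n. C n) \<noteq> {}"
  proof (rule nested_convex_Inter_nonempty)
    show "decseq C"
      unfolding C_def decseq_def by (intro allI impI closure_mono hull_mono) auto
    show "w n \<in> C n" for n
      unfolding C_def by (rule subsetD[OF closure_subset], rule hull_inc) auto
  qed (auto simp: C_def convex_closure assms)
  then obtain p where p: "\<And>n. p \<in> C n"
    by blast
  have "hull_cluster_point w p"
    unfolding hull_cluster_point_def
  proof (intro allI impI)
    fix u c
    assume "\<forall>\<^sub>F k in sequentially. c \<le> w k \<bullet> u"
    then obtain n where "\<And>k. k \<ge> n \<Longrightarrow> c \<le> w k \<bullet> u"
      by (auto simp: eventually_sequentially)
    then have "C n \<subseteq> {x. u \<bullet> x \<ge> c}"
      unfolding C_def
      by (intro closure_minimal hull_minimal convex_halfspace_ge closed_halfspace_ge)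
         (auto simp: inner_commute)
    with p show "c \<le> p \<bullet> u"
      by (auto simp: inner_commute)
  qed
  then show thesis ..
qed

text \<open>Convergent distances to two points of \<open>F\<close> force hull cluster points to
  coincide. Asking for one along every subsequence then plays the role of weak compactness.\<close>

lemma Opial:
  fixes z :: "nat \<Rightarrow> 'a::real_inner"
  assumes conv: "\<And>q. q \<in> F \<Longrightarrow> convergent (\<lambda>k. norm (z k - q))"
    and cluster: "\<And>r. strict_mono r \<Longrightarrow> \<exists>p\<in>F. hull_cluster_point (z \<circ> r) p"
  shows "\<exists>p\<in>F. weakly_converges z p"
proof -
  have unique: "p = q"
    if "p \<in> F" "q \<in> F" and cl: "hull_cluster_point z p" "hull_cluster_point z q" for p q
  proof -
    obtain a b where "(\<lambda>k. norm (z k - p)) \<longlonglongrightarrow> a" "(\<lambda>k. norm (z k - q)) \<longlonglongrightarrow> b"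
      using conv[OF \<open>p \<in> F\<close>] conv[OF \<open>q \<in> F\<close>] unfolding convergent_def by blast
    then have "(\<lambda>k. ((norm (z k - q))\<^sup>2 - (norm (z k - p))\<^sup>2 + (norm p)\<^sup>2 - (norm q)\<^sup>2) / 2)
      \<longlonglongrightarrow> (b\<^sup>2 - a\<^sup>2 + (norm p)\<^sup>2 - (norm q)\<^sup>2) / 2"
      by (intro tendsto_intros) auto
    \<comment> \<open>The squared norm of \<open>z k\<close> cancels, so convergence of the two
      distances gives convergence of \<open>z k\<close> tested against \<open>p - q\<close>.\<close>
    moreover have "((norm (z k - q))\<^sup>2 - (norm (z k - p))\<^sup>2 + (norm p)\<^sup>2 - (norm q)\<^sup>2) / 2
      = z k \<bullet> (p - q)" for k
      by (simp only: power2_norm_eq_inner) (simp add: inner_diff inner_commute)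
    ultimately have "(\<lambda>k. z k \<bullet> (p - q)) \<longlonglongrightarrow> (b\<^sup>2 - a\<^sup>2 + (norm p)\<^sup>2 - (norm q)\<^sup>2) / 2"
      by simp
    then have "p \<bullet> (p - q) = q \<bullet> (p - q)"
      using cl hull_cluster_point_lim by metis
    then have "(p - q) \<bullet> (p - q) = 0"
      by (simp add: inner_diff_left)
    then show ?thesis
      by simp
  qed
  obtain p where p: "p \<in> F" "hull_cluster_point z p"
    using cluster[of id] by (auto simp: strict_mono_def)
  \<comment> \<open>If this fails infinitely often, a subsequence stays in the half-space beyond
    \<open>p \<bullet> u + e\<close>, and so does its hull cluster point \<open>q\<close>;
    uniqueness gives \<open>q = p\<close>, a contradiction. The lower estimate follows with
    \<open>- u\<close>.\<close>
  have upper: "\<forall>\<^sub>F k in sequentially. z k \<bullet> u < p \<bullet> u + e" if "e > 0" for u and e :: real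
  proof (rule ccontr)
    assume "\<not> ?thesis"
    then have "infinite {k. p \<bullet> u + e \<le> z k \<bullet> u}"
      unfolding not_eventually INFM_iff_infinite[symmetric] cofinite_eq_sequentially
      by (simp add: not_less)
    then obtain r :: "nat \<Rightarrow> nat" where r: "strict_mono r" "\<And>k. p \<bullet> u + e \<le> z (r k) \<bullet> u"
      using infinite_enumerate by blast
    obtain q where q: "q \<in> F" "hull_cluster_point (z \<circ> r) q"
      using cluster[OF r(1)] by blast
    then have "p \<bullet> u + e \<le> q \<bullet> u"
      using r(2) by (simp add: hull_cluster_point_def)
    moreover have "p = q"
      using unique p q hull_cluster_point_subseq r(1) by blast
    ultimately show False
      using that by simp
  qed
  have "(\<lambda>k. z k \<bullet> u) \<longlonglongrightarrow> p \<bullet> u" for u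
  proof (rule tendstoI)
    fix e :: real
    assume "e > 0"
    from upper[OF this, of u] upper[OF this, of "- u"]
    show "\<forall>\<^sub>F k in sequentially. dist (z k \<bullet> u) (p \<bullet> u) < e"
      by eventually_elim (simp add: dist_real_def abs_less_iff)
  qed
  with p show ?thesis
    by (auto simp: weakly_converges_def)
qed

text \<open>Only the inequality at \<open>p\<close> itself is used, so a half-space estimate replaces the weak limit.\<close>

lemma hull_cluster_point_in_Fix:
  fixes w :: "nat \<Rightarrow> 'a::real_inner"
  assumes bdd: "bounded (range w)" and p: "hull_cluster_point w p"
    and avg: "\<And>k. conically_averaged (\<eta> k) (T k)" and \<eta>: "\<And>k. \<eta> k \<le> M"
    and res: "(\<lambda>k. w k - T k (w k)) \<longlonglongrightarrow> 0" and T: "(\<lambda>k. T k p) \<longlonglongrightarrow> S p"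
  shows "p \<in> Fix S"
proof -
  define s where "s k = (w k - T k (w k)) - (p - T k p)" for k
  define t where "t = S p - p"
  have "s \<longlonglongrightarrow> 0 - (p - S p)"
    unfolding s_def by (intro tendsto_intros res T)
  then have s: "s \<longlonglongrightarrow> t"
    by (simp add: t_def)
  have "\<eta> 0 > 0"
    using avg by (simp add: conically_averaged_def)
  with \<eta>[of 0] have "M > 0"
    by simp
  obtain B where B: "\<And>k. norm (w k) \<le> B"
    using bdd by (auto simp: bounded_iff)
  \<comment> \<open>Cocoercivity bounds \<open>(w k - p) \<bullet> s k\<close> below. Replacing
    \<open>s k\<close> by its strong limit \<open>t\<close> costs a vanishing Cauchy-Schwarz error
    and leaves \<open>w k\<close> tested in a fixed direction.\<close>
  have le: "(norm (s k))\<^sup>2 / (2 * M) - (B + norm p) * norm (s k - t) + p \<bullet> t \<le> w k \<bullet> t" for k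
  proof -
    have pos: "\<eta> k > 0"
      using avg by (simp add: conically_averaged_def)
    have 1: "(norm (s k))\<^sup>2 \<le> 2 * \<eta> k * ((w k - p) \<bullet> s k)"
      unfolding s_def using conically_averaged_inner[OF avg] .
    then have "0 \<le> 2 * \<eta> k * ((w k - p) \<bullet> s k)"
      using zero_le_power2 order_trans by blast
    then have "0 \<le> (w k - p) \<bullet> s k"
      using pos by (simp add: zero_le_mult_iff)
    then have "2 * \<eta> k * ((w k - p) \<bullet> s k) \<le> 2 * M * ((w k - p) \<bullet> s k)"
      using \<eta>[of k] by (intro mult_right_mono) auto
    with 1 have 2: "(norm (s k))\<^sup>2 / (2 * M) \<le> (w k - p) \<bullet> s k"
      using \<open>M > 0\<close> by (simp add: field_simps)
    have "(w k - p) \<bullet> (s k - t) \<le> norm (w k - p) * norm (s k - t)"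
      by (rule norm_cauchy_schwarz)
    also have "\<dots> \<le> (B + norm p) * norm (s k - t)"
      using B[of k] norm_triangle_ineq4[of "w k" p] by (intro mult_right_mono) auto
    finally show ?thesis
      using 2 by (simp add: inner_diff)
  qed
  have "(\<lambda>k. (norm (s k))\<^sup>2 / (2 * M) - (B + norm p) * norm (s k - t) + p \<bullet> t)
    \<longlonglongrightarrow> (norm t)\<^sup>2 / (2 * M) - (B + norm p) * norm (t - t) + p \<bullet> t"
    using \<open>M > 0\<close> by (intro tendsto_intros s) auto
  \<comment> \<open>The term \<open>p \<bullet> t\<close> stands on both sides and cancels.\<close>
  from hull_cluster_point_ge_lim[OF p this le] have "(norm t)\<^sup>2 / (2 * M) \<le> 0"
    by simp
  then have "t = 0"
    using \<open>M > 0\<close> by (simp add: divide_le_0_iff)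
  then show ?thesis
    by (simp add: t_def Fix_def)
qed

subsection \<open>The relocated fixed-point iteration\<close>

theorem theorem3p5:
  fixes \<Theta> \<Gamma> :: "real set"
    and T :: "real \<Rightarrow> real \<Rightarrow> 'a::{real_inner, complete_space} \<Rightarrow> 'a"
    and \<eta> :: "real \<Rightarrow> real \<Rightarrow> real"
    and Q :: "real \<Rightarrow> real \<Rightarrow> 'a \<Rightarrow> 'a"
    and L :: "real \<Rightarrow> real \<Rightarrow> real"
    and \<theta> \<gamma> lam :: "nat \<Rightarrow> real"
    and \<theta>bar \<gamma>bar :: real
    and z :: "nat \<Rightarrow> 'a"
  assumes "\<Theta> \<subseteq> {0<..}" and "\<Theta> \<noteq> {}" and "closed \<Theta>" and "0 \<notin> \<Theta>"
    and "\<Gamma> \<subseteq> {0<..}" and "\<Gamma> \<noteq> {}" and "closed \<Gamma>" and "0 \<notin> \<Gamma>"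
    and "\<forall>t\<in>\<Theta>. \<forall>g\<in>\<Gamma>. \<eta> t g > 0 \<and> conically_averaged (\<eta> t g) (T t g)"
    and "0 \<notin> (\<lambda>(t, g). \<eta> t g) ` (\<Theta> \<times> \<Gamma>)"
    and "\<theta>bar \<in> \<Theta>"
    and "\<forall>t\<in>\<Theta>. \<forall>g\<in>\<Gamma>. Fix (T t g) = Fix (T \<theta>bar g) \<and> Fix (T \<theta>bar g) \<noteq> {}"
    and "fixed_point_relocators \<Gamma> (T \<theta>bar) Q L"
    and "\<forall>k. \<gamma> k \<in> \<Gamma>" and "\<gamma>bar \<in> \<Gamma>" and "\<gamma> \<longlonglongrightarrow> \<gamma>bar"
    and "summable (\<lambda>k. L (\<gamma> (Suc k)) (\<gamma> k) - 1)"
    and "\<forall>k. \<theta> k \<in> \<Theta>"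
    and "\<forall>k. lam k > 0"
    and "liminf (\<lambda>k. ereal (inverse (\<eta> (\<theta> k) (\<gamma> k)) * lam k * (1 - \<eta> (\<theta> k) (\<gamma> k) * lam k))) > 0"
    and "\<forall>k. z (Suc k) = Q (\<gamma> (Suc k)) (\<gamma> k)
                ((1 - lam k) *\<^sub>R z k + lam k *\<^sub>R T (\<theta> k) (\<gamma> k) (z k))"
  shows "(bounded (range z) \<and> (\<lambda>k. z k - T (\<theta> k) (\<gamma> k) (z k)) \<longlonglongrightarrow> 0) \<and>
    ((\<forall>x. continuous_on (\<Theta> \<times> \<Gamma>) (\<lambda>(t, g). T t g x)) \<and>
      bounded (range \<theta>) \<and> separated_from_zero \<theta> \<and>
      liminf (\<lambda>k. ereal (\<eta> (\<theta> k) (\<gamma> k))) > 0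
      \<longrightarrow> (\<exists>p\<in>Fix (T \<theta>bar \<gamma>bar). weakly_converges z p \<and>
            weakly_converges (\<lambda>k. T (\<theta> k) (\<gamma> k) (z k)) p))"
proof -
  define a where "a k = \<eta> (\<theta> k) (\<gamma> k)" for k
  define res where "res k = z k - T (\<theta> k) (\<gamma> k) (z k)" for k
  define F where "F = Fix (T \<theta>bar \<gamma>bar)"
  define Lk where "Lk k = L (\<gamma> (Suc k)) (\<gamma> k)" for k
  note reloc = assms(13)
  have \<gamma>: "\<gamma> k \<in> \<Gamma>" and \<theta>: "\<theta> k \<in> \<Theta>" and lam: "lam k > 0" for k
    using assms by auto
  have avg: "conically_averaged (a k) (T (\<theta> k) (\<gamma> k))" for k
    using assms(9) \<gamma> \<theta> by (auto simp: a_def)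
  have apos: "a k > 0" for k
    using avg by (simp add: conically_averaged_def)
  have FixT: "Fix (T t g) = Fix (T \<theta>bar g)" if "t \<in> \<Theta>" "g \<in> \<Gamma>" for t g
    using assms(12) that by blast
  have L1: "Lk k \<ge> 1"
    and lip: "(Lk k)-lipschitz_on UNIV (Q (\<gamma> (Suc k)) (\<gamma> k))" for k
    using reloc \<gamma> unfolding fixed_point_relocators_def Lk_def by blast+
  have summ: "summable (\<lambda>k. Lk k - 1)"
    using assms(17) by (simp add: Lk_def)
  obtain e where e: "e > 0"
    and ev: "\<forall>\<^sub>F k in sequentially. e < inverse (a k) * lam k * (1 - a k * lam k)"
  proof -
    obtain e where "0 < ereal e"
      "ereal e < liminf (\<lambda>k. ereal (inverse (a k) * lam k * (1 - a k * lam k)))"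
      using ereal_dense2[OF assms(20)] by (auto simp: a_def)
    then show thesis
      using that[of e] less_LiminfD by fastforce
  qed

  \<comment> \<open>Quasi-Fejer estimate along the relocated points\<close>
  have key: "convergent (\<lambda>k. norm (z k - Q (\<gamma> k) \<gamma>bar y)) \<and> res \<longlonglongrightarrow> 0" if y: "y \<in> F" for y
  proof -
    define x where "x k = Q (\<gamma> k) \<gamma>bar y" for k
    define b where "b k = norm (z k - x k)" for k
    have x_Fix: "x k \<in> Fix (T (\<theta> k) (\<gamma> k))" for k
    proof -
      have "bij_betw (Q (\<gamma> k) \<gamma>bar) F (Fix (T \<theta>bar (\<gamma> k)))"
        using reloc \<gamma> assms(15) unfolding fixed_point_relocators_def F_def by blast
      then show ?thesis
        using y FixT[OF \<theta> \<gamma>] by (auto simp: bij_betw_def x_def)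
    qed
    \<comment> \<open>Composition law for \<gamma>bar, \<open>\<gamma> k\<close>,
      \<open>\<gamma> (Suc k)\<close>: the operator that produces \<open>z (Suc k)\<close> also
      produces \<open>x (Suc k)\<close>, so its Lipschitz bound compares the two.\<close>
    have x_Suc: "x (Suc k) = Q (\<gamma> (Suc k)) (\<gamma> k) (x k)" for k
      using reloc \<gamma> assms(15) y unfolding fixed_point_relocators_def F_def x_def by metis
    have step: "(b (Suc k))\<^sup>2 \<le> (Lk k)\<^sup>2 *
        ((b k)\<^sup>2 - inverse (a k) * lam k * (1 - a k * lam k) * (norm (res k))\<^sup>2)" for k
    proof -
      define w where "w = (1 - lam k) *\<^sub>R z k + lam k *\<^sub>R T (\<theta> k) (\<gamma> k) (z k)"
      have "z (Suc k) = Q (\<gamma> (Suc k)) (\<gamma> k) w"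
        using assms(21) by (simp add: w_def)
      then have "b (Suc k) \<le> Lk k * norm (w - x k)"
        using lipschitz_onD[OF lip, of w "x k" k] by (simp add: b_def x_Suc dist_norm)
      then have "(b (Suc k))\<^sup>2 \<le> (Lk k)\<^sup>2 * (norm (w - x k))\<^sup>2"
        using power_mono[of "b (Suc k)" "Lk k * norm (w - x k)" 2]
        by (simp add: b_def power_mult_distrib)
      also have "\<dots> \<le> (Lk k)\<^sup>2 *
        ((b k)\<^sup>2 - inverse (a k) * lam k * (1 - a k * lam k) * (norm (res k))\<^sup>2)"
        unfolding w_def b_def res_def
        by (intro mult_left_mono conically_averaged_relaxed_step avg x_Fix less_imp_le[OF lam]) auto
      finally show ?thesis .
    qed
    have step': "\<forall>\<^sub>F k in sequentially. (b (Suc k))\<^sup>2 \<le> (Lk k)\<^sup>2 * ((b k)\<^sup>2 - e * (norm (res k))\<^sup>2)"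
      using ev
    proof eventually_elim
      case (elim k)
      then have "e * (norm (res k))\<^sup>2
          \<le> inverse (a k) * lam k * (1 - a k * lam k) * (norm (res k))\<^sup>2"
        by (intro mult_right_mono) auto
      then have "(Lk k)\<^sup>2 * ((b k)\<^sup>2 - inverse (a k) * lam k * (1 - a k * lam k) * (norm (res k))\<^sup>2)
          \<le> (Lk k)\<^sup>2 * ((b k)\<^sup>2 - e * (norm (res k))\<^sup>2)"
        by (intro mult_left_mono) auto
      with step[of k] show ?case
        by linarith
    qed
    have conv: "convergent b"
    proof (rule convergent_quasi_decreasing[OF _ _ summ])
      show "\<forall>\<^sub>F k in sequentially. b (Suc k) \<le> Lk k * b k"
        using step'
      proof eventually_elim
        case (elim k)
        also have "(Lk k)\<^sup>2 * ((b k)\<^sup>2 - e * (norm (res k))\<^sup>2) \<le> (Lk k)\<^sup>2 * (b k)\<^sup>2"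
          using e by (intro mult_left_mono) auto
        finally have "(b (Suc k))\<^sup>2 \<le> (Lk k * b k)\<^sup>2"
          by (simp add: power_mult_distrib)
        then show ?case
          by (rule power2_le_imp_le) (use L1[of k] in \<open>simp add: b_def\<close>)
      qed
    qed (simp add: b_def)
    then obtain l where l: "b \<longlonglongrightarrow> l"
      by (auto simp: convergent_def)
    have "(\<lambda>k. Lk k - 1 + 1) \<longlonglongrightarrow> 0 + 1"
      by (intro tendsto_intros summable_LIMSEQ_zero summ)
    then have "Lk \<longlonglongrightarrow> 1"
      by simp
    \<comment> \<open>Solving \<open>step'\<close> for the residual bounds its squared norm by this
      expression, where both squares of \<open>b\<close> tend to \<open>l^2\<close>.\<close>
    then have "(\<lambda>k. ((b k)\<^sup>2 - (b (Suc k))\<^sup>2 / (Lk k)\<^sup>2) / e) \<longlonglongrightarrow> (l\<^sup>2 - l\<^sup>2 / 1\<^sup>2) / e"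
      using e by (intro tendsto_intros l LIMSEQ_Suc) auto
    then have "(\<lambda>k. ((b k)\<^sup>2 - (b (Suc k))\<^sup>2 / (Lk k)\<^sup>2) / e) \<longlonglongrightarrow> 0"
      by simp
    then have "(\<lambda>k. (norm (res k))\<^sup>2) \<longlonglongrightarrow> 0"
    proof (rule tendsto_sandwich[rotated 3])
      show "\<forall>\<^sub>F k in sequentially. (norm (res k))\<^sup>2 \<le> ((b k)\<^sup>2 - (b (Suc k))\<^sup>2 / (Lk k)\<^sup>2) / e"
        using step'
      proof eventually_elim
        case (elim k)
        then have "(b (Suc k))\<^sup>2 / (Lk k)\<^sup>2 \<le> (b k)\<^sup>2 - e * (norm (res k))\<^sup>2"
          using L1[of k] by (simp add: divide_le_eq mult.commute)
        then show ?case
          using e by (simp add: le_divide_eq mult.commute)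
      qed
    qed auto
    then have "(\<lambda>k. sqrt ((norm (res k))\<^sup>2)) \<longlonglongrightarrow> sqrt 0"
      by (rule tendsto_real_sqrt)
    then have "res \<longlonglongrightarrow> 0"
      by (simp add: tendsto_norm_zero_iff)
    with conv show ?thesis
      by (simp add: b_def[abs_def] x_def)
  qed

  \<comment> \<open>Opial's argument needs distances to fixed points \<open>y\<close>; since the
    relocated points converge strongly to \<open>y\<close>, the reverse triangle inequality
    transfers the limit.\<close>
  have distconv: "convergent (\<lambda>k. norm (z k - y))" if y: "y \<in> F" for y
  proof -
    obtain l where "(\<lambda>k. norm (z k - Q (\<gamma> k) \<gamma>bar y)) \<longlonglongrightarrow> l"
      using key[OF y] by (auto simp: convergent_def)
    moreover have "(\<lambda>k. norm (z k - y) - norm (z k - Q (\<gamma> k) \<gamma>bar y)) \<longlonglongrightarrow> 0"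
    proof (rule Lim_null_comparison)
      have "(\<lambda>k. Q (\<gamma> k) \<gamma>bar y) \<longlonglongrightarrow> y"
        using relocated_tendsto[OF reloc assms(14,15,16)] y by (simp add: F_def)
      then show "(\<lambda>k. norm (Q (\<gamma> k) \<gamma>bar y - y)) \<longlonglongrightarrow> 0"
        by (simp add: LIM_zero tendsto_norm_zero)
      show "\<forall>\<^sub>F k in sequentially. norm (norm (z k - y) - norm (z k - Q (\<gamma> k) \<gamma>bar y))
          \<le> norm (Q (\<gamma> k) \<gamma>bar y - y)"
      proof (rule always_eventually, rule allI)
        fix k
        show "norm (norm (z k - y) - norm (z k - Q (\<gamma> k) \<gamma>bar y)) \<le> norm (Q (\<gamma> k) \<gamma>bar y - y)"
          using norm_triangle_ineq3[of "z k - y" "z k - Q (\<gamma> k) \<gamma>bar y"] by simp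
      qed
    qed
    ultimately have "(\<lambda>k. norm (z k - Q (\<gamma> k) \<gamma>bar y)
        + (norm (z k - y) - norm (z k - Q (\<gamma> k) \<gamma>bar y))) \<longlonglongrightarrow> l + 0"
      by (rule tendsto_add)
    then show ?thesis
      by (auto simp: convergent_def)
  qed

  obtain y where y: "y \<in> F"
    using assms(11,12,15) unfolding F_def by blast
  have res0: "res \<longlonglongrightarrow> 0"
    using key[OF y] by blast
  have bdd: "bounded (range z)"
  proof -
    have "Bseq (\<lambda>k. norm (z k - y))"
      using distconv[OF y] by (rule convergent_imp_Bseq)
    then obtain B where B: "\<And>k. norm (z k - y) \<le> B"
      by (auto simp: Bseq_def)
    then have "norm (z k) \<le> B + norm y" for k
      using norm_triangle_sub[of "z k" y] B[of k] by linarith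
    then show ?thesis
      by (auto simp: bounded_iff)
  qed

  \<comment> \<open>Weak convergence of the iterates and their images\<close>
  have ii: "\<exists>p\<in>F. weakly_converges z p \<and> weakly_converges (\<lambda>k. T (\<theta> k) (\<gamma> k) (z k)) p"
    if cont: "\<And>x. continuous_on (\<Theta> \<times> \<Gamma>) (\<lambda>(t, g). T t g x)" and b\<theta>: "bounded (range \<theta>)"
  proof -
    \<comment> \<open>The liminf condition also bounds \<open>a k\<close> above: multiplying by its
      square gives \<open>(a k)^2 * e \<le> t * (1 - t) \<le> 1/4\<close> with
      \<open>t = a k * lam k\<close>, and \<open>a k \<le> 1 + (a k)^2\<close>.\<close>
    have a_le: "\<forall>\<^sub>F k in sequentially. a k \<le> 1 + inverse (4 * e)"
      using ev
    proof eventually_elim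
      case (elim k)
      have "(a k)\<^sup>2 * e \<le> (a k)\<^sup>2 * (inverse (a k) * lam k * (1 - a k * lam k))"
        using elim by (intro mult_left_mono) auto
      also have "\<dots> = a k * lam k * (1 - a k * lam k)"
        using apos[of k] by (simp add: power2_eq_square field_simps)
      also have "\<dots> \<le> 1 / 4"
        using zero_le_power2[of "a k * lam k - 1 / 2"]
        by (simp add: power2_eq_square algebra_simps)
      finally have "(a k)\<^sup>2 \<le> inverse (4 * e)"
        using e by (simp add: field_simps)
      moreover have "a k \<le> 1 + (a k)\<^sup>2"
        using zero_le_power2[of "a k - 1 / 2"] by (simp add: power2_eq_square algebra_simps)
      ultimately show ?case
        by linarith
    qed
    then obtain N where N: "\<And>k. k \<ge> N \<Longrightarrow> a k \<le> 1 + inverse (4 * e)"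
      by (auto simp: eventually_sequentially)
    have "\<exists>p\<in>F. hull_cluster_point (z \<circ> r) p" if r: "strict_mono r" for r
    proof -
      have "bounded (range (\<theta> \<circ> r))"
        using b\<theta> by (rule bounded_subset) auto
      then obtain t s where s: "strict_mono s" and t: "(\<theta> \<circ> r \<circ> s) \<longlonglongrightarrow> t"
        using bounded_imp_convergent_subsequence by blast
      \<comment> \<open>The shift by \<open>N\<close> makes the bound on \<open>a\<close> hold at
        every index of the subsequence.\<close>
      define m where "m k = r (s (k + N))" for k
      have mono: "strict_mono (\<lambda>k. s (k + N))" "strict_mono m"
        using r s by (auto simp: m_def strict_mono_def)
      have mN: "m k \<ge> N" for k
        using seq_suble[OF strict_mono_o[OF r s], of "k + N"] by (simp add: m_def)
      have \<theta>m: "(\<lambda>k. \<theta> (m k)) \<longlonglongrightarrow> t"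
        using LIMSEQ_ignore_initial_segment[OF t, of N] by (simp add: m_def)
      have \<gamma>m: "(\<lambda>k. \<gamma> (m k)) \<longlonglongrightarrow> \<gamma>bar"
        using LIMSEQ_subseq_LIMSEQ[OF assms(16) mono(2)] by (simp add: o_def)
      have t\<Theta>: "t \<in> \<Theta>"
        using closed_sequentially[OF assms(3) _ \<theta>m] \<theta> by blast
      have bm: "bounded (range (z \<circ> m))"
        using bdd by (rule bounded_subset) auto
      then obtain p where p: "hull_cluster_point (z \<circ> m) p"
        by (rule bounded_imp_hull_cluster_point)
      have "(\<lambda>k. case (\<theta> (m k), \<gamma> (m k)) of (t, g) \<Rightarrow> T t g p)
          \<longlonglongrightarrow> (case (t, \<gamma>bar) of (t, g) \<Rightarrow> T t g p)"
        by (rule continuous_on_tendsto_compose[OF cont])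
           (use t\<Theta> assms(15) \<theta> \<gamma> in \<open>auto intro: tendsto_Pair \<theta>m \<gamma>m\<close>)
      then have Tm: "(\<lambda>k. T (\<theta> (m k)) (\<gamma> (m k)) p) \<longlonglongrightarrow> T t \<gamma>bar p"
        by simp
      have "p \<in> Fix (T t \<gamma>bar)"
      proof (rule hull_cluster_point_in_Fix[OF bm p])
        show "conically_averaged (a (m k)) (T (\<theta> (m k)) (\<gamma> (m k)))" for k
          by (rule avg)
        show "a (m k) \<le> 1 + inverse (4 * e)" for k
          by (rule N[OF mN])
        show "(\<lambda>k. (z \<circ> m) k - T (\<theta> (m k)) (\<gamma> (m k)) ((z \<circ> m) k)) \<longlonglongrightarrow> 0"
          using LIMSEQ_subseq_LIMSEQ[OF res0 mono(2)] by (simp add: o_def res_def)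
      qed (rule Tm)
      \<comment> \<open>The limit \<open>t\<close> depends on the subsequence, but lies in the
        closed set \<Theta>, and the fixed-point set is the same for all parameters there.\<close>
      then have "p \<in> F"
        using FixT[OF t\<Theta> assms(15)] by (simp add: F_def)
      moreover have "hull_cluster_point (z \<circ> r) p"
        using p mono(1) by (intro hull_cluster_point_subseq[of "z \<circ> r" "\<lambda>k. s (k + N)"])
          (simp_all add: m_def[abs_def] o_def)
      ultimately show ?thesis
        by blast
    qed
    then obtain p where p: "p \<in> F" and w: "weakly_converges z p"
      using Opial[OF distconv] by blast
    have "(\<lambda>k. z k \<bullet> u - res k \<bullet> u) \<longlonglongrightarrow> p \<bullet> u - 0 \<bullet> u" for u
      using w unfolding weakly_converges_def
      by (intro tendsto_diff tendsto_inner[OF res0 tendsto_const]) blast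
    then have "weakly_converges (\<lambda>k. T (\<theta> k) (\<gamma> k) (z k)) p"
      by (simp add: weakly_converges_def res_def inner_diff_left)
    with p w show ?thesis
      by blast
  qed
  show ?thesis
    using bdd res0 ii by (auto simp: res_def[abs_def] F_def)
qed

end
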